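(* Let $\gamma_{\rm th}>0$ and define the outage probability $p_{\rm out}=\mathbb{P}[\Gamma_{\rm d}\le\gamma_{\rm th}]$, where $\Gamma_{\rm d}=\gamma_{\rm srd}/\gamma_{\rm v}$ is as defined in the context. Then $$p_{\rm out}=\mathcal{A}-\frac{\omega\sqrt{\beta_{\rm sd}}}{\sqrt{\beta_{\rm sd}+2\sigma^2}}\,\mathcal{B},$$ where, with $a_t=\frac{1}{\beta_{\rm sd}}+\frac{1}{2\sigma^2}$, $$\mathcal{A}=1-\omega\int_0^\infty Q\left(\frac{\sqrt{\gamma_{\rm th}x}-\mu\sqrt{\bar\gamma_{\rm s}}}{\sigma\sqrt{\bar\gamma_{\rm s}}}\right)f_{\gamma_{\rm v}}(x)\,dx,$$ $$\mathcal{B}=\int_0^\infty \exp\left(-\frac{(\sqrt{\gamma_{\rm th}x}-\mu\sqrt{\bar\gamma_{\rm s}})^2}{2\beta_{\rm sd}a_t\bar\gamma_{\rm s}\sigma^2}\right)\left[1-Q\left(\sqrt{\frac{2}{a_t\bar\gamma_{\rm s}}}\left(\frac{\sqrt{\gamma_{\rm th}x}}{\beta_{\rm sd}}+\frac{\mu\sqrt{\bar\gamma_{\rm s}}}{2\sigma^2}\right)\right)-Q\left(\sqrt{\frac{2}{a_t\bar\gamma_{\rm s}}}\,\frac{\sqrt{\gamma_{\rm th}x}-\mu\sqrt{\bar\gamma_{\rm s}}}{2\sigma^2}\right)\right]f_{\gamma_{\rm v}}(x)\,dx.$$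
   Context: $Q(t)=\frac{1}{\sqrt{2\pi}}\int_t^\infty e^{-u^2/2}du$ is the Gaussian $Q$-function. The positive constants $\beta_{\rm sr},\beta_{\rm rd},\beta_{\rm sd},\beta_{\rm bd},\bar\gamma_{\rm s},\bar\gamma_{\rm b}$, the amplitude $\alpha\in(0,1]$ and the integers $N,M\ge 1$ are given. Set $$\mu=\frac{N\alpha\pi}{4}\sqrt{\beta_{\rm sr}\beta_{\rm rd}},\qquad \sigma^2=N\alpha^2\beta_{\rm sr}\beta_{\rm rd}\left(1-\frac{\pi^2}{16}\right)\ (\sigma>0),\qquad \omega=\frac{1}{Q(-\mu/\sigma)}.$$ The following random variables are mutually independent. (i) $R=|h_{\rm sd}|$ with $h_{\rm sd}\sim\mathcal{CN}(0,\beta_{\rm sd})$, so $\mathbb{P}[R\le r]=1-e^{-r^2/\beta_{\rm sd}}$ for $r\ge0$. (ii) $X\ge 0$ with cumulative distribution function $F_X(x)=1-\omega Q\left(\frac{x-\mu}{\sigma}\right)$ for $x\ge 0$ (and $0$ for $x<0$). This is the Gaussian model, based on the central limit theorem, of the reflected amplitude $\sum_{n=1}^N\alpha|h_{{\rm sr},n}||h_{{\rm rd},n}|$. (iii) $h_{{\rm bd},1},\dots,h_{{\rm bd},M}$ i.i.d. $\mathcal{CN}(0,\beta_{\rm bd})$. Put $\gamma_{\rm srd}=\bar\gamma_{\rm s}(R+X)^2$, $\gamma_{\rm v}=1+\bar\gamma_{\rm b}\max_{1\le m\le M}|h_{{\rm bd},m}|^2$ and $\Gamma_{\rm d}=\gamma_{\rm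 srd}/\gamma_{\rm v}$. The function $f_{\gamma_{\rm v}}$ denotes the probability density of $\gamma_{\rm v}$, namely, with $\alpha_{\rm bd}=\bar\gamma_{\rm b}\beta_{\rm bd}$, $$f_{\gamma_{\rm v}}(x)=\sum_{m=1}^M(-1)^{m+1}\binom{M}{m}\frac{m}{\alpha_{\rm bd}}e^{-m(x-1)/\alpha_{\rm bd}}\quad(x\ge 1),\qquad f_{\gamma_{\rm v}}(x)=0\quad (x<1).$$ *)

theory Defs
  imports "HOL-Probability.Probability"
begin

definition gaussian_Q :: "real \<Rightarrow> real" where
  "gaussian_Q t = 1 / sqrt (2 * pi) * (LBINT u:{t..}. exp (- u\<^sup>2 / 2))"

text \<open>
  The law \<open>CN(c, v)\<close>, circularly symmetric with \<^emph>\<open>total\<close> variance \<open>v\<close> (so the real and the imaginary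
  part have variance \<open>v / 2\<close> each), given by its density with respect to Lebesgue measure on
  the complex plane.
\<close>

definition complex_normal_density :: "complex \<Rightarrow> real \<Rightarrow> complex \<Rightarrow> real" where
  "complex_normal_density c v z = exp (- (cmod (z - c))\<^sup>2 / v) / (pi * v)"

definition complex_normal :: "'a measure \<Rightarrow> ('a \<Rightarrow> complex) \<Rightarrow> complex \<Rightarrow> real \<Rightarrow> bool" where
  "complex_normal P h c v \<longleftrightarrow> distributed P lborel h (\<lambda>z. ennreal (complex_normal_density c v z))"

text \<open>
  Indices for the mutually independent family consisting of \<open>R\<close>, \<open>X\<close> and the \<open>h m\<close>. The
  notion \<open>indep_vars\<close> requires a common codomain; viewing the real variables \<open>R\<close> and \<open>X\<close> as
  complex ones does not change the sigma-algebras they generate.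
\<close>

datatype channel = Direct | Reflected | Backscatter nat

fun channel_var ::
  "('a \<Rightarrow> real) \<Rightarrow> ('a \<Rightarrow> real) \<Rightarrow> (nat \<Rightarrow> 'a \<Rightarrow> complex) \<Rightarrow> channel \<Rightarrow> 'a \<Rightarrow> complex" where
  "channel_var R X h Direct = (\<lambda>w. complex_of_real (R w))"
| "channel_var R X h Reflected = (\<lambda>w. complex_of_real (X w))"
| "channel_var R X h (Backscatter m) = h m"

end

theory Submission
  imports Defs "HOL-Real_Asymp.Real_Asymp"
begin

text \<open>
  Conditioning on the independent \<open>\<gamma>\<^sub>v\<close> turns the outage probability into
  the mean of \<open>P (R + X \<le> sqrt (\<gamma>\<^sub>t\<^sub>h v / g\<^sub>s))\<close> over the law of \<open>\<gamma>\<^sub>v\<close>.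
  Conditioning once more on \<open>X\<close>, which is a normal variable truncated to \<open>X \<ge> 0\<close>, the Rayleigh tail
  \<open>exp (- (t - x)\<^sup>2 / \<beta>\<^sub>s\<^sub>d)\<close> times the normal density is, after completing the square, a constant
  multiple of another normal density, whose integral over \<open>[0, t]\<close> is a difference of two values of \<open>Q\<close>.
\<close>

section \<open>The Q-function as a normal tail integral\<close>

lemma gaussian_Q_eq_normal_integral:
  "gaussian_Q t = (LBINT x:{t..}. std_normal_density x)"
  by (simp add: gaussian_Q_def std_normal_density_def set_lebesgue_integral_def
      mult.left_commute[of "indicator _ _"] flip: integral_mult_right_zero)

lemma set_integrable_normal_density:
  assumes "0 < s" "A \<in> sets borel"
  shows "set_integrable lborel A (normal_density m s)"
  using integrable_normal_density[OF assms(1), of m] assms(2)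
  unfolding set_integrable_def by (intro integrable_mult_indicator) auto

text \<open>Standardization: substituting m + s x for x, the Jacobian \<open>s\<close> cancels the
  factor 1/s in the density.\<close>

lemma normal_integral_atLeast:
  assumes "0 < s"
  shows "(LBINT x:{y..}. normal_density m s x) = gaussian_Q ((y - m) / s)"
proof -
  have "(LBINT x:{y..}. normal_density m s x) =
      s * (LBINT x. indicator {y..} (m + s * x) * normal_density m s (m + s * x))"
    using assms lborel_integral_real_affine[of s "\<lambda>x. indicator {y..} x * normal_density m s x" m]
    by (simp add: set_lebesgue_integral_def)
  also have "\<dots> = (LBINT x. indicator {(y - m) / s..} x * std_normal_density x)"
    using assms
    by (auto simp: normal_density_def indicator_def field_simps real_sqrt_mult power_mult_distrib
        simp flip: integral_mult_right_zero intro!: Bochner_Integration.integral_cong)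
  finally show ?thesis
    by (simp add: gaussian_Q_eq_normal_integral set_lebesgue_integral_def)
qed

lemma normal_integral_atLeastAtMost:
  assumes "0 < s" "a \<le> b"
  shows "(LBINT x:{a..b}. normal_density m s x) = gaussian_Q ((a - m) / s) - gaussian_Q ((b - m) / s)"
proof -
  \<comment> \<open>The ray is cut into two disjoint pieces; closing the second one at the null
    point \<open>b\<close> makes it a tail again.\<close>
  have "(LBINT x:{a..}. normal_density m s x) =
      (LBINT x:{a..b} \<union> {b<..}. normal_density m s x)"
    using assms by (intro arg_cong[where f="\<lambda>A. set_lebesgue_integral _ A _"]) auto
  also have "\<dots> = (LBINT x:{a..b}. normal_density m s x) + (LBINT x:{b<..}. normal_density m s x)"
    using assms by (intro set_integral_Un set_integrable_normal_density) auto
  also have "(LBINT x:{b<..}. normal_density m s x) = (LBINT x:{b..}. normal_density m s x)"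
    unfolding set_lebesgue_integral_def
    by (rule integral_cong_AE, simp_all, use AE_lborel_singleton[of b] in eventually_elim)
      (auto simp: indicator_def)
  finally show ?thesis
    using normal_integral_atLeast[OF assms(1), of a m] normal_integral_atLeast[OF assms(1), of b m]
    by simp
qed

lemma gaussian_Q_nonneg: "0 \<le> gaussian_Q t"
  unfolding gaussian_Q_eq_normal_integral set_lebesgue_integral_def
  by (intro integral_nonneg_AE) auto

lemma gaussian_Q_antimono:
  assumes "a \<le> b"
  shows "gaussian_Q b \<le> gaussian_Q a"
proof -
  have "0 \<le> (LBINT x:{a..b}. std_normal_density x)"
    unfolding set_lebesgue_integral_def by (intro integral_nonneg_AE) auto
  then show ?thesis
    using normal_integral_atLeastAtMost[of 1 a b 0] assms by simp
qed

text \<open>The reflection at 0 preserves the even density and carries the tail to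
  \<open>{..t}\<close>, which up to the null point \<open>t\<close> is the complement of
  \<open>{t..}\<close>; the total mass is 1.\<close>

lemma gaussian_Q_uminus: "gaussian_Q (- t) = 1 - gaussian_Q t"
proof -
  have "gaussian_Q (- t) = (LBINT x. indicator {- t..} (0 + (- 1) * x) * std_normal_density (0 + (- 1) * x))"
    using lborel_integral_real_affine[of "-1" "\<lambda>x. indicator {- t..} x * std_normal_density x" 0]
    by (simp add: gaussian_Q_eq_normal_integral set_lebesgue_integral_def)
  also have "\<dots> = (LBINT x:{..t}. std_normal_density x)"
    by (auto simp: set_lebesgue_integral_def normal_density_def indicator_def intro!: Bochner_Integration.integral_cong)
  also have "\<dots> = (LBINT x:{..<t}. std_normal_density x)"
    unfolding set_lebesgue_integral_def
    by (rule integral_cong_AE, simp_all, use AE_lborel_singleton[of t] in eventually_elim)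
      (auto simp: indicator_def)
  finally have "gaussian_Q (- t) + gaussian_Q t = (LBINT x:{..<t} \<union> {t..}. std_normal_density x)"
    unfolding gaussian_Q_eq_normal_integral
    by (subst set_integral_Un) (auto intro!: set_integrable_normal_density)
  also have "{..<t} \<union> {t..} = UNIV" by auto
  finally show ?thesis
    by (simp add: set_lebesgue_integral_def)
qed

lemma gaussian_Q_le_1: "gaussian_Q t \<le> 1"
  using gaussian_Q_uminus[of t] gaussian_Q_nonneg[of "- t"] by simp

text \<open>The reflection formula at 0 gives the value 1/2 there, and monotonicity does the rest.
  This makes the denominator of \<omega> positive.\<close>

lemma gaussian_Q_pos_of_nonpos:
  assumes "t \<le> 0"
  shows "0 < gaussian_Q t"
  using gaussian_Q_uminus[of 0] gaussian_Q_antimono[OF assms] by simp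

lemma borel_measurable_gaussian_Q [measurable]: "gaussian_Q \<in> borel_measurable borel"
proof -
  \<comment> \<open>Measurability comes from monotonicity, after a change of sign.\<close>
  have "(\<lambda>t. - gaussian_Q t) \<in> borel_measurable borel"
    by (intro borel_measurable_mono monoI) (simp add: gaussian_Q_antimono)
  then show ?thesis by simp
qed

section \<open>Tail of the modulus of a complex normal variable\<close>

lemma emeasure_annulus:
  assumes "0 \<le> r" "r\<^sup>2 \<le> u"
  shows "emeasure lborel {z::complex. r < cmod z \<and> (cmod z)\<^sup>2 \<le> u} = ennreal (pi * (u - r\<^sup>2))"
proof -
  have r: "r \<le> sqrt u" using assms by (simp add: real_le_rsqrt)
  \<comment> \<open>A difference of concentric discs. The lower bound on the modulus is to come from
    the tail event, the upper one from the auxiliary variable \<open>u\<close> of Fubini.\<close>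
  have "{z::complex. r < cmod z \<and> (cmod z)\<^sup>2 \<le> u} = cball 0 (sqrt u) - cball 0 r"
    using assms by (auto simp: not_le real_le_rsqrt intro: sqrt_ge_absD)
  then have "emeasure lborel {z::complex. r < cmod z \<and> (cmod z)\<^sup>2 \<le> u} =
      emeasure lborel (cball (0::complex) (sqrt u)) - emeasure lborel (cball (0::complex) r)"
    using r emeasure_lborel_cball_finite[of "0::complex" r]
    by (simp add: emeasure_Diff cball_subset_cball_iff less_top)
  also have "\<dots> = ennreal (pi * (u - r\<^sup>2))"
    using assms r order_trans[OF zero_le_power2 assms(2)]
    by (simp add: emeasure_cball unit_ball_vol_2 ennreal_minus algebra_simps)
  finally show ?thesis .
qed

lemma nn_integral_exponential_tail:
  assumes "0 < (b::real)"
  shows "(\<integral>\<^sup>+u. ennreal (exp (- u / b) / b) * indicator {a..} u \<partial>lborel) = ennreal (exp (- a / b))"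
proof -
  have "((\<lambda>u. - exp (- u / b)) \<longlongrightarrow> 0) at_top"
    using assms by real_asymp
  then have "(\<integral>\<^sup>+u. ennreal (exp (- u / b) / b) * indicator {a..} u \<partial>lborel) =
      ennreal (0 - (- exp (- a / b)))"
    using assms by (intro nn_integral_FTC_atLeast) (auto intro!: derivative_eq_intros)
  then show ?thesis by simp
qed

lemma nn_integral_gamma_tail:
  assumes "0 < (b::real)"
  shows "(\<integral>\<^sup>+u. ennreal ((u - a) * exp (- u / b) / b\<^sup>2) * indicator {a..} u \<partial>lborel) = ennreal (exp (- a / b))"
proof -
  \<comment> \<open>The primitive comes from integration by parts; at \<open>a\<close> it equals -
    exp (- a / b).\<close>
  have "((\<lambda>u. - ((u - a) / b + 1) * exp (- u / b)) \<longlongrightarrow> 0) at_top"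
    using assms by real_asymp
  then have "(\<integral>\<^sup>+u. ennreal ((u - a) * exp (- u / b) / b\<^sup>2) * indicator {a..} u \<partial>lborel) =
      ennreal (0 - (- ((a - a) / b + 1) * exp (- a / b)))"
    using assms by (intro nn_integral_FTC_atLeast)
      (auto intro!: derivative_eq_intros simp: field_simps power2_eq_square)
  then show ?thesis by simp
qed

text \<open>Writing \<open>exp (- (cmod z)\<^sup>2 / v)\<close> as an integral of \<open>exp (- u / v) / v\<close> over \<open>u \<ge> (cmod z)\<^sup>2\<close>
  and applying Fubini reduces the tail to areas of annuli, so that no polar coordinates are needed.\<close>

lemma nn_integral_complex_normal_tail:
  assumes "0 < v" "0 \<le> r"
  shows "(\<integral>\<^sup>+z. ennreal (complex_normal_density 0 v z) * indicator {z. r < cmod z} z \<partial>lborel) =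
    ennreal (exp (- r\<^sup>2 / v))"
proof -
  have "(\<integral>\<^sup>+z. ennreal (complex_normal_density 0 v z) * indicator {z. r < cmod z} z \<partial>lborel) =
     (\<integral>\<^sup>+z. (\<integral>\<^sup>+u. ennreal (1 / (pi * v)) * (ennreal (exp (- u / v) / v) *
        indicator {(cmod z)\<^sup>2..} u) * indicator {z. r < cmod z} z \<partial>lborel) \<partial>lborel)"
    using assms nn_integral_exponential_tail[OF assms(1)]
    by (intro nn_integral_cong, subst nn_integral_multc, simp, subst nn_integral_cmult)
      (simp_all add: complex_normal_density_def flip: ennreal_mult)
  also have "\<dots> = (\<integral>\<^sup>+u. (\<integral>\<^sup>+z. ennreal (1 / (pi * v)) * (ennreal (exp (- u / v) / v) *
        indicator {(cmod z)\<^sup>2..} u) * indicator {z. r < cmod z} z \<partial>lborel) \<partial>lborel)"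
    by (rule lborel_pair.Fubini') (simp add: indicator_def case_prod_beta)
  also have "\<dots> = (\<integral>\<^sup>+u. ennreal ((u - r\<^sup>2) * exp (- u / v) / v\<^sup>2) * indicator {r\<^sup>2..} u \<partial>lborel)"
  proof (rule nn_integral_cong)
    fix u :: real
    let ?A = "{z::complex. r < cmod z \<and> (cmod z)\<^sup>2 \<le> u}"
    \<comment> \<open>For fixed \<open>u\<close> the weight is constant in \<open>z\<close>, and the
      two indicators cut out the annulus.\<close>
    have "(\<integral>\<^sup>+z. ennreal (1 / (pi * v)) * (ennreal (exp (- u / v) / v) *
        indicator {(cmod z)\<^sup>2..} u) * indicator {z. r < cmod z} z \<partial>lborel) =
       (\<integral>\<^sup>+z. ennreal (exp (- u / v) / (pi * v\<^sup>2)) * indicator ?A z \<partial>lborel)"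
      using assms by (intro nn_integral_cong)
         (auto simp: indicator_def power2_eq_square mult_ac simp flip: ennreal_mult)
    also have "\<dots> = ennreal (exp (- u / v) / (pi * v\<^sup>2)) * emeasure lborel ?A"
      by (subst nn_integral_cmult_indicator) auto
    also have "\<dots> = ennreal ((u - r\<^sup>2) * exp (- u / v) / v\<^sup>2) * indicator {r\<^sup>2..} u"
    proof (cases "r\<^sup>2 \<le> u")
      case True
      then show ?thesis
        using assms by (simp add: emeasure_annulus mult_ac flip: ennreal_mult)
    next
      case False
      \<comment> \<open>For \<open>u\<close> below \<open>r\<^sup>2\<close> the annulus is empty,
        which produces the indicator of \<open>{r\<^sup>2..}\<close>.\<close>
      have "\<not> (cmod z)\<^sup>2 \<le> u" if "r < cmod z" for z
        using False power_mono[of r "cmod z" 2] that assms by linarith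
      then have "?A = {}" by auto
      then show ?thesis using False by (simp only: emeasure_empty) simp
    qed
    finally show "(\<integral>\<^sup>+z. ennreal (1 / (pi * v)) * (ennreal (exp (- u / v) / v) *
        indicator {(cmod z)\<^sup>2..} u) * indicator {z. r < cmod z} z \<partial>lborel) =
      ennreal ((u - r\<^sup>2) * exp (- u / v) / v\<^sup>2) * indicator {r\<^sup>2..} u" .
  qed
  also have "\<dots> = ennreal (exp (- r\<^sup>2 / v))"
    using assms by (intro nn_integral_gamma_tail)
  finally show ?thesis .
qed

section \<open>Densities from cdfs, and conditioning on an independent variable\<close>

lemma real_distribution_eq_densityI:
  assumes "real_distribution D" "\<And>x. emeasure (density lborel f) {..x} = ennreal (cdf D x)"
  shows "D = density lborel f"
proof -
  interpret real_distribution D by fact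
  show ?thesis
  \<comment> \<open>Uniqueness of measures: the half-lines form an intersection-stable generator of
    the Borel sets, and the \<open>{..real i}\<close> exhaust the line with finite
    \<open>D\<close>-measure.\<close>
  proof (rule measure_eqI_generator_eq[where \<Omega>=UNIV and E="range (\<lambda>x::real. {..x})" and A="\<lambda>i. {..real i}"])
    show "Int_stable (range (\<lambda>x::real. {..x}))"
      by (auto simp: Int_stable_def)
    show "sets D = sigma_sets UNIV (range (\<lambda>x::real. {..x}))"
      "sets (density lborel f) = sigma_sets UNIV (range (\<lambda>x::real. {..x}))"
      by (simp_all add: borel_eq_atMost)
    show "(\<Union>i. {..real i}) = UNIV"
      using real_arch_simple by auto
  qed (auto simp: assms(2) cdf_def emeasure_eq_measure)
qed

text \<open>By independence the joint law is a product, and the section of the event at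
  \<open>v\<close> is the half-line up to \<open>\<phi> v\<close>, so Fubini leaves a cdf to be
  averaged. It serves both for conditioning on \<open>\<gamma>\<^sub>v\<close> and, with
  \<open>\<phi>\<close> of the form t - x, for the convolution of \<open>R\<close> and
  \<open>X\<close>.\<close>

lemma (in prob_space) prob_indep_le_function:
  fixes U V :: "'a \<Rightarrow> real"
  assumes UV: "indep_var borel U borel V" and \<phi> [measurable]: "\<phi> \<in> borel_measurable borel"
  shows "prob {w \<in> space M. U w \<le> \<phi> (V w)} = (\<integral>v. cdf (distr M borel U) (\<phi> v) \<partial>distr M borel V)"
proof -
  have [measurable]: "U \<in> borel_measurable M" "V \<in> borel_measurable M"
    using indep_var_rv1[OF UV] indep_var_rv2[OF UV] by auto
  let ?U = "distr M borel U" and ?V = "distr M borel V"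
  interpret U: real_distribution ?U by simp
  interpret V: real_distribution ?V by simp
  interpret UV: pair_prob_space ?U ?V ..
  have [measurable]: "cdf ?U \<in> borel_measurable borel"
    by (intro borel_measurable_mono monoI U.cdf_nondecreasing)
  let ?A = "{p. fst p \<le> \<phi> (snd p)}"
  have "{p \<in> space (borel \<Otimes>\<^sub>M borel). fst p \<le> \<phi> (snd p)} \<in> sets (borel \<Otimes>\<^sub>M borel)"
    by measurable
  then have A [measurable]: "?A \<in> sets (borel \<Otimes>\<^sub>M borel)"
    by (simp add: space_pair_measure)
  then have A': "?A \<in> sets (?U \<Otimes>\<^sub>M ?V)"
    by (simp cong: sets_pair_measure_cong)
  have "emeasure M {w \<in> space M. U w \<le> \<phi> (V w)} = emeasure (distr M (borel \<Otimes>\<^sub>M borel) (\<lambda>w. (U w, V w))) ?A"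
    by (subst emeasure_distr) (auto intro!: arg_cong[where f="emeasure M"])
  also have "\<dots> = emeasure (?U \<Otimes>\<^sub>M ?V) ?A"
    using UV by (simp add: indep_var_distribution_eq)
  also have "\<dots> = (\<integral>\<^sup>+v. ennreal (cdf ?U (\<phi> v)) \<partial>?V)"
    by (simp add: UV.emeasure_pair_measure_alt2[OF A'] cdf_def vimage_def atMost_def U.emeasure_eq_measure)
  also have "\<dots> = ennreal (\<integral>v. cdf ?U (\<phi> v) \<partial>?V)"
    by (intro nn_integral_eq_integral V.integrable_const_bound[where B=1])
      (auto simp: U.cdf_nonneg U.cdf_bounded_prob)
  finally show ?thesis
    by (simp add: emeasure_eq_measure U.cdf_nonneg)
qed

section \<open>The Rayleigh law\<close>

lemma (in prob_space) prob_cmod_complex_normal_le: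
  assumes h: "complex_normal M h 0 v" and "0 < v" "0 \<le> r"
  shows "prob {w \<in> space M. cmod (h w) \<le> r} = 1 - exp (- r\<^sup>2 / v)"
proof -
  have d: "distributed M lborel h (\<lambda>z. ennreal (complex_normal_density 0 v z))"
    using h by (simp add: complex_normal_def)
  have [measurable]: "h \<in> borel_measurable M"
    using distributed_measurable[OF d] by simp
  have "emeasure M (h -` {z. r < cmod z} \<inter> space M) = ennreal (exp (- r\<^sup>2 / v))"
    using nn_integral_complex_normal_tail[OF assms(2,3)]
    by (subst distributed_emeasure[OF d]) auto
  then have "prob {w \<in> space M. r < cmod (h w)} = exp (- r\<^sup>2 / v)"
    by (simp add: emeasure_eq_measure vimage_def Int_def conj_commute)
  moreover have "{w \<in> space M. r < cmod (h w)} = space M - {w \<in> space M. cmod (h w) \<le> r}"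
    by auto
  ultimately show ?thesis
    by (simp add: prob_compl)
qed

lemma (in prob_space) cdf_cmod_complex_normal:
  assumes h: "complex_normal M h 0 v" and "0 < v"
  shows "cdf (distr M borel (\<lambda>w. cmod (h w))) r = (if 0 \<le> r then 1 - exp (- r\<^sup>2 / v) else 0)"
proof -
  have [measurable]: "h \<in> borel_measurable M"
    using h by (auto simp: complex_normal_def dest: distributed_measurable)
  have "cdf (distr M borel (\<lambda>w. cmod (h w))) r = prob {w \<in> space M. cmod (h w) \<le> r}"
    by (auto simp: cdf_def measure_distr intro!: arg_cong[where f=prob])
  also have "\<dots> = (if 0 \<le> r then 1 - exp (- r\<^sup>2 / v) else 0)"
  proof (cases "0 \<le> r")
    case True
    then show ?thesis using prob_cmod_complex_normal_le[OF assms] by simp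
  next
    case False
    then have "{w \<in> space M. cmod (h w) \<le> r} = {}"
      using norm_ge_zero order_trans by blast
    then show ?thesis using False by (simp only: measure_empty if_False)
  qed
  finally show ?thesis .
qed

section \<open>Law of the interference term built from the largest backscatter gain\<close>

lemma sum_choose_weighted:
  fixes q :: real
  assumes "1 \<le> M"
  shows "(\<Sum>m=1..M. (- 1) ^ (m + 1) * real (M choose m) * real m * q ^ m) = real M * q * (1 - q) ^ (M - 1)"
proof -
  obtain n where M: "M = Suc n" using assms by (cases M) auto
  \<comment> \<open>Shifting to m = k + 1 turns the sign into (-1)^k. Absorbing m into the binomial
    coefficient then gives M times (M - 1 choose k), so the binomial theorem applies.\<close>
  have "(\<Sum>m=1..M. (- 1) ^ (m + 1) * real (M choose m) * real m * q ^ m) =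
      (\<Sum>k\<le>n. (- 1) ^ k * (real (Suc k * (Suc n choose Suc k))) * q ^ Suc k)"
    unfolding M One_nat_def sum.shift_bounds_cl_Suc_ivl atLeast0AtMost
    by (intro sum.cong) (simp_all add: algebra_simps)
  also have "\<dots> = (\<Sum>k\<le>n. real (Suc n) * q * (real (n choose k) * (- q) ^ k * 1 ^ (n - k)))"
    unfolding Suc_times_binomial by (intro sum.cong) (simp_all add: power_minus[of q] algebra_simps)
  also have "\<dots> = real (Suc n) * q * (- q + 1) ^ n"
    by (simp only: binomial_ring sum_distrib_left)
  finally show ?thesis by (simp add: M)
qed

text \<open>On \<open>{1..}\<close> the function \<open>f\<close> is the derivative of (1 - exp (-
  (x - 1) / a)) ^ M, whose value at 1 is 0 because \<open>M\<close> is positive.\<close>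

lemma emeasure_density_exponential_max:
  fixes f :: "real \<Rightarrow> real"
  assumes "0 < a" "1 \<le> M"
    and f: "\<And>x. 1 \<le> x \<Longrightarrow> f x = real M / a * exp (- (x - 1) / a) * (1 - exp (- (x - 1) / a)) ^ (M - 1)"
    and f0: "\<And>x. x < 1 \<Longrightarrow> f x = 0" and [measurable]: "f \<in> borel_measurable borel"
  shows "emeasure (density lborel f) {..x} = ennreal (if 1 \<le> x then (1 - exp (- (x - 1) / a)) ^ M else 0)"
proof -
  have "emeasure (density lborel f) {..x} = (\<integral>\<^sup>+u. ennreal (f u) * indicator {1..x} u \<partial>lborel)"
    by (auto simp: emeasure_density indicator_def f0 not_le intro!: nn_integral_cong)
  also have "\<dots> = ennreal (if 1 \<le> x then (1 - exp (- (x - 1) / a)) ^ M else 0)"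
  proof (cases "1 \<le> x")
    case True
    have "(\<integral>\<^sup>+u. ennreal (f u) * indicator {1..x} u \<partial>lborel) =
        (1 - exp (- (x - 1) / a)) ^ M - (1 - exp (- (1 - 1) / a)) ^ M"
      using True assms(1,2)
      by (intro nn_integral_FTC_Icc)
        (auto simp: f divide_nonpos_pos intro!: derivative_eq_intros divide_nonneg_pos mult_nonneg_nonneg)
    then show ?thesis using True assms(2) by (simp add: power_0_left)
  qed simp
  finally show ?thesis .
qed

text \<open>The maximum stays below a level iff every squared modulus does, so independence gives a
  product of equal Rayleigh cdfs. For \<open>x\<close> below 1 the level is negative and the event
  is empty.\<close>

lemma (in prob_space) cdf_affine_Max_complex_normal:
  assumes ind: "indep_vars (\<lambda>_. borel) Z I" and I: "finite I" "I \<noteq> {}"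
    and Z: "\<And>i. i \<in> I \<Longrightarrow> complex_normal M (Z i) 0 v" and "0 < v" "0 < g"
  shows "cdf (distr M borel (\<lambda>w. 1 + g * (MAX i\<in>I. (cmod (Z i w))\<^sup>2))) x =
    (if 1 \<le> x then (1 - exp (- (x - 1) / (g * v))) ^ card I else 0)"
proof -
  have [measurable]: "Z i \<in> borel_measurable M" if "i \<in> I" for i
    using ind that by (auto simp: indep_vars_def)
  have [measurable]: "(\<lambda>w. MAX i\<in>I. (cmod (Z i w))\<^sup>2) \<in> borel_measurable M"
    using I by (intro borel_measurable_Max) auto
  let ?y = "(x - 1) / g"
  have "cdf (distr M borel (\<lambda>w. 1 + g * (MAX i\<in>I. (cmod (Z i w))\<^sup>2))) x =
      prob {w \<in> space M. 1 + g * (MAX i\<in>I. (cmod (Z i w))\<^sup>2) \<le> x}"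
    by (auto simp: cdf_def measure_distr intro!: arg_cong[where f=prob])
  also have "{w \<in> space M. 1 + g * (MAX i\<in>I. (cmod (Z i w))\<^sup>2) \<le> x} = {w \<in> space M. \<forall>i\<in>I. (cmod (Z i w))\<^sup>2 \<le> ?y}"
  proof -
    have "1 + g * m \<le> x \<longleftrightarrow> m \<le> ?y" for m
      using \<open>0 < g\<close> by (auto simp: field_simps)
    then show ?thesis using I by (simp only:) simp
  qed
  also have "prob \<dots> = (if 1 \<le> x then (1 - exp (- (x - 1) / (g * v))) ^ card I else 0)"
  proof (cases "1 \<le> x")
    case True
    then have y: "0 \<le> ?y" using \<open>0 < g\<close> by simp
    have sq: "(cmod z)\<^sup>2 \<le> ?y \<longleftrightarrow> cmod z \<le> sqrt ?y" for z
      using real_le_rsqrt sqrt_ge_absD[of "cmod z" ?y] by auto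
    have "{w \<in> space M. \<forall>i\<in>I. (cmod (Z i w))\<^sup>2 \<le> ?y} = (\<Inter>i\<in>I. Z i -` cball 0 (sqrt ?y) \<inter> space M)"
      unfolding sq using I by auto
    also have "prob \<dots> = (\<Prod>i\<in>I. prob (Z i -` cball 0 (sqrt ?y) \<inter> space M))"
      using ind I by (intro indep_varsD_finite) auto
    also have "\<dots> = (\<Prod>i\<in>I. 1 - exp (- ?y / v))"
    proof (rule prod.cong)
      fix i assume "i \<in> I"
      moreover have "Z i -` cball 0 (sqrt ?y) \<inter> space M = {w \<in> space M. cmod (Z i w) \<le> sqrt ?y}"
        by auto
      ultimately show "prob (Z i -` cball 0 (sqrt ?y) \<inter> space M) = 1 - exp (- ?y / v)"
        using prob_cmod_complex_normal_le[OF Z \<open>0 < v\<close>, of i "sqrt ?y"] y by simp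
    qed simp
    finally show ?thesis using True by (simp add: minus_divide_left)
  next
    case False
    then have "?y < 0" using \<open>0 < g\<close> by (simp add: divide_neg_pos)
    then have "\<not> (cmod z)\<^sup>2 \<le> ?y" for z
      using zero_le_power2[of "cmod z"] by linarith
    then have "{w \<in> space M. \<forall>i\<in>I. (cmod (Z i w))\<^sup>2 \<le> ?y} = {}" using I by auto
    then show ?thesis using False by (simp only: measure_empty if_False)
  qed
  finally show ?thesis .
qed

section \<open>Independence of the derived variables\<close>

lemma (in prob_space) indep_channels:
  assumes ind: "indep_vars (\<lambda>_. borel) (channel_var R X h) ({Direct, Reflected} \<union> Backscatter ` {1..n})"
  shows indep_direct_reflected: "indep_var borel R borel X"
    and indep_sum_Max_backscatter:
      "indep_var borel (\<lambda>w. R w + X w) borel (\<lambda>w. 1 + g * (MAX i\<in>Backscatter ` {1..n}. (cmod (channel_var R X h i w))\<^sup>2))"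
      (is "indep_var borel _ borel ?V")
proof -
  \<comment> \<open>Disjoint blocks of an independent family are independent, and so are measurable
    functions of them; \<open>Re\<close> undoes the embedding of the real variables into the complex
    plane.\<close>
  have "indep_var borel ((\<lambda>f. Re (f Direct)) \<circ> (\<lambda>w. restrict (\<lambda>i. channel_var R X h i w) {Direct}))
      borel ((\<lambda>f. Re (f Reflected)) \<circ> (\<lambda>w. restrict (\<lambda>i. channel_var R X h i w) {Reflected}))"
    by (rule indep_var_compose[OF indep_var_restrict[OF ind]]) auto
  then show "indep_var borel R borel X"
    by (simp add: comp_def)
  \<comment> \<open>Measurability on the product space of the block, needed to compose with its
    projection.\<close>
  have "(\<lambda>f. 1 + g * (MAX i\<in>Backscatter ` {1..n}. (cmod (f i))\<^sup>2))
      \<in> borel_measurable (PiM (Backscatter ` {1..n}) (\<lambda>_. borel))"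
    by (intro borel_measurable_add borel_measurable_times borel_measurable_const borel_measurable_Max
        borel_measurable_power measurable_compose[OF _ borel_measurable_norm] measurable_component_singleton
        finite_imageI finite_atLeastAtMost)
  then have "indep_var borel ((\<lambda>f. Re (f Direct) + Re (f Reflected)) \<circ>
        (\<lambda>w. restrict (\<lambda>i. channel_var R X h i w) {Direct, Reflected}))
      borel ((\<lambda>f. 1 + g * (MAX i\<in>Backscatter ` {1..n}. (cmod (f i))\<^sup>2)) \<circ>
        (\<lambda>w. restrict (\<lambda>i. channel_var R X h i w) (Backscatter ` {1..n})))"
    by (intro indep_var_compose[OF indep_var_restrict[OF ind]]) auto
  then show "indep_var borel (\<lambda>w. R w + X w) borel ?V"
    by (simp add: comp_def cong: image_cong_simp)
qed

section \<open>Law of the sum of direct and reflected amplitudes\<close>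

lemma distr_eq_truncated_normal_density:
  assumes D: "real_distribution D" and "0 < \<sigma>" "\<mu> \<ge> 0"
    and \<omega>: "\<omega> = 1 / gaussian_Q (- \<mu> / \<sigma>)"
    and cdf: "\<And>x. cdf D x = (if 0 \<le> x then 1 - \<omega> * gaussian_Q ((x - \<mu>) / \<sigma>) else 0)"
  shows "D = density lborel (\<lambda>x. ennreal (\<omega> * normal_density \<mu> \<sigma> x * indicator {0..} x))"
proof (rule real_distribution_eq_densityI[OF D])
  fix x
  have Q: "0 < gaussian_Q (- \<mu> / \<sigma>)"
    using assms by (intro gaussian_Q_pos_of_nonpos) simp
  have "emeasure (density lborel (\<lambda>x. ennreal (\<omega> * normal_density \<mu> \<sigma> x * indicator {0..} x))) {..x} =
      (\<integral>\<^sup>+u. ennreal (\<omega> * (indicator {0..x} u * normal_density \<mu> \<sigma> u)) \<partial>lborel)"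
    by (auto simp: emeasure_density indicator_def intro!: nn_integral_cong)
  also have "\<dots> = ennreal (\<integral>u. \<omega> * (indicator {0..x} u * normal_density \<mu> \<sigma> u) \<partial>lborel)"
    using Q \<omega> set_integrable_normal_density[OF \<open>0 < \<sigma>\<close>, of "{0..x}" \<mu>]
    by (intro nn_integral_eq_integral) (auto simp: set_integrable_def)
  also have "(\<integral>u. \<omega> * (indicator {0..x} u * normal_density \<mu> \<sigma> u) \<partial>lborel) =
      \<omega> * (LBINT u:{0..x}. normal_density \<mu> \<sigma> u)"
    by (simp add: set_lebesgue_integral_def)
  \<comment> \<open>The normal law gives \<open>{0..}\<close> the mass Q(- \<mu> / \<sigma>), so
    \<omega> is exactly the normalizing factor of the truncation.\<close>
  also have "\<dots> = cdf D x"
  proof (cases "0 \<le> x")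
    case True
    then show ?thesis
      using normal_integral_atLeastAtMost[OF \<open>0 < \<sigma>\<close> True, of \<mu>] Q
      by (simp add: cdf \<omega> diff_divide_distrib)
  next
    case False
    then show ?thesis by (simp add: cdf set_lebesgue_integral_def)
  qed
  finally show "emeasure (density lborel (\<lambda>x. ennreal (\<omega> * normal_density \<mu> \<sigma> x * indicator {0..} x))) {..x} =
    ennreal (cdf D x)" .
qed

text \<open>Completing the square: the joint exponent has quadratic coefficient - \<open>a\<close>
  in \<open>x\<close>, hence the new variance 1 / (2 a) and a centre equal to half the linear
  coefficient divided by \<open>a\<close>. The factor with the two roots is the ratio of the new
  standard deviation to \<sigma>.\<close>

lemma rayleigh_tail_mult_normal_density:
  fixes t :: real
  assumes "0 < \<beta>" "0 < \<sigma>" and a: "a = 1 / \<beta> + 1 / (2 * \<sigma>\<^sup>2)"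
  shows "exp (- (t - x)\<^sup>2 / \<beta>) * normal_density \<mu> \<sigma> x =
    sqrt \<beta> / sqrt (\<beta> + 2 * \<sigma>\<^sup>2) * exp (- ((t - \<mu>)\<^sup>2 / (2 * \<beta> * a * \<sigma>\<^sup>2))) *
    normal_density ((t / \<beta> + \<mu> / (2 * \<sigma>\<^sup>2)) / a) (1 / sqrt (2 * a)) x"
proof -
  have pos: "0 < \<beta> + 2 * \<sigma>\<^sup>2" "0 < a" "0 < \<sigma>\<^sup>2"
    using assms by (auto intro!: add_pos_pos)
  have a': "a = (\<beta> + 2 * \<sigma>\<^sup>2) / (2 * \<beta> * \<sigma>\<^sup>2)"
    using assms by (simp add: field_simps)
  let ?c = "(t / \<beta> + \<mu> / (2 * \<sigma>\<^sup>2)) / a"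
  have "- (t - x)\<^sup>2 / \<beta> - (x - \<mu>)\<^sup>2 / (2 * \<sigma>\<^sup>2) = - ((t - \<mu>)\<^sup>2 / (2 * \<beta> * a * \<sigma>\<^sup>2)) - a * (x - ?c)\<^sup>2"
  proof -
    have "a * (x - ?c)\<^sup>2 = a * x\<^sup>2 - 2 * x * (a * ?c) + (a * ?c)\<^sup>2 / a"
      using pos(2) by (simp add: power2_eq_square field_simps)
    also have "\<dots> = a * x\<^sup>2 - 2 * x * (t / \<beta> + \<mu> / (2 * \<sigma>\<^sup>2)) + (t / \<beta> + \<mu> / (2 * \<sigma>\<^sup>2))\<^sup>2 / a"
      using pos by simp
    finally have e1: "a * (x - ?c)\<^sup>2 = \<dots>" .
    have e2: "(t - \<mu>)\<^sup>2 / (2 * \<beta> * a * \<sigma>\<^sup>2) = (t - \<mu>)\<^sup>2 / (\<beta> + 2 * \<sigma>\<^sup>2)"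
      using assms(1,2) unfolding a' by simp
    \<comment> \<open>The square of half the linear coefficient over \<open>a\<close> is the
      constant term of the original exponent less the residual that stays in front.\<close>
    have e3: "(t / \<beta> + \<mu> / (2 * \<sigma>\<^sup>2))\<^sup>2 / a = t\<^sup>2 / \<beta> + \<mu>\<^sup>2 / (2 * \<sigma>\<^sup>2) - (t - \<mu>)\<^sup>2 / (\<beta> + 2 * \<sigma>\<^sup>2)"
      using assms(1,2) less_imp_neq[OF pos(1)] unfolding a' by (simp add: divide_simps) algebra
    show ?thesis
      unfolding e1 e2 e3 using assms by (simp add: a field_simps power2_eq_square)
  qed
  moreover have "1 / sqrt (2 * pi * \<sigma>\<^sup>2) = sqrt \<beta> / sqrt (\<beta> + 2 * \<sigma>\<^sup>2) * (1 / sqrt (2 * pi * (1 / sqrt (2 * a))\<^sup>2))"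
  proof -
    \<comment> \<open>The squares of the normalizing constants are compared first, using 1 / (2 a) =
      \<beta> \<sigma>^2 / (\<beta> + 2 \<sigma>^2); roots are taken afterwards.\<close>
    have "1 / (2 * pi * \<sigma>\<^sup>2) = \<beta> / (\<beta> + 2 * \<sigma>\<^sup>2) * (1 / (2 * pi * (1 / sqrt (2 * a))\<^sup>2))"
    proof -
      have "(1 / sqrt (2 * a))\<^sup>2 = \<beta> * \<sigma>\<^sup>2 / (\<beta> + 2 * \<sigma>\<^sup>2)"
      proof -
        have "1 / (2 * (X / (2 * \<beta> * \<sigma>\<^sup>2))) = \<beta> * \<sigma>\<^sup>2 / X" for X
          by simp
        from this[of "\<beta> + 2 * \<sigma>\<^sup>2"] show ?thesis
          unfolding a'[symmetric] using pos(2) by (simp add: power_divide)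
      qed
      moreover have "1 / (2 * pi * \<sigma>\<^sup>2) = \<beta> / X * (1 / (2 * pi * (\<beta> * \<sigma>\<^sup>2 / X)))" if "X \<noteq> 0" for X
        using that pos(3) assms(1) by simp
      ultimately show ?thesis
        using less_imp_neq[OF pos(1)] by metis
    qed
    then show ?thesis
      by (metis real_sqrt_divide real_sqrt_mult real_sqrt_one)
  qed
  moreover have "(x - ?c)\<^sup>2 / (2 * (1 / sqrt (2 * a))\<^sup>2) = a * (x - ?c)\<^sup>2"
    using pos by (simp add: power_divide)
  ultimately show ?thesis
    unfolding normal_density_def by (simp add: mult_ac flip: exp_add)
qed

text \<open>In the convolution the two supports confine \<open>x\<close> to \<open>{0..t}\<close>.
  The constant 1 of the Rayleigh cdf yields the first difference of Q-values; its exponential part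
  yields the second one via the completed square.\<close>

lemma (in prob_space) cdf_add_rayleigh_truncated_normal:
  assumes ind: "indep_var borel R borel X" and pos: "0 < \<beta>" "0 < \<sigma>" "0 \<le> \<omega>" "0 \<le> t"
    and R: "\<And>r. cdf (distr M borel R) r = (if 0 \<le> r then 1 - exp (- r\<^sup>2 / \<beta>) else 0)"
    and X: "distr M borel X = density lborel (\<lambda>x. ennreal (\<omega> * normal_density \<mu> \<sigma> x * indicator {0..} x))"
    and a: "a = 1 / \<beta> + 1 / (2 * \<sigma>\<^sup>2)"
  shows "cdf (distr M borel (\<lambda>w. R w + X w)) t =
    \<omega> * (gaussian_Q (- \<mu> / \<sigma>) - gaussian_Q ((t - \<mu>) / \<sigma>)) -
    \<omega> * sqrt \<beta> / sqrt (\<beta> + 2 * \<sigma>\<^sup>2) *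
      (exp (- ((t - \<mu>)\<^sup>2 / (2 * \<beta> * a * \<sigma>\<^sup>2))) *
       (1 - gaussian_Q (sqrt (2 / a) * (t / \<beta> + \<mu> / (2 * \<sigma>\<^sup>2))) - gaussian_Q (sqrt (2 / a) * ((t - \<mu>) / (2 * \<sigma>\<^sup>2)))))"
proof -
  have [measurable]: "R \<in> borel_measurable M" "X \<in> borel_measurable M"
    using indep_var_rv1[OF ind] indep_var_rv2[OF ind] by auto
  have "0 < a" using pos by (auto simp: a intro!: add_pos_pos)
  let ?K = "sqrt \<beta> / sqrt (\<beta> + 2 * \<sigma>\<^sup>2) * exp (- ((t - \<mu>)\<^sup>2 / (2 * \<beta> * a * \<sigma>\<^sup>2)))"
  let ?c = "(t / \<beta> + \<mu> / (2 * \<sigma>\<^sup>2)) / a" and ?s = "1 / sqrt (2 * a)"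
  have "cdf (distr M borel (\<lambda>w. R w + X w)) t = prob {w \<in> space M. R w \<le> t - X w}"
    by (auto simp: cdf_def measure_distr algebra_simps intro!: arg_cong[where f=prob])
  also have "\<dots> = (\<integral>x. cdf (distr M borel R) (t - x) \<partial>distr M borel X)"
    by (intro prob_indep_le_function ind) simp
  also have "\<dots> = (\<integral>x. \<omega> * normal_density \<mu> \<sigma> x * indicator {0..} x * cdf (distr M borel R) (t - x) \<partial>lborel)"
    unfolding X R using pos by (subst integral_real_density) auto
  also have "\<dots> = (\<integral>x. \<omega> * (indicator {0..t} x * normal_density \<mu> \<sigma> x) -
      \<omega> * ?K * (indicator {0..t} x * normal_density ?c ?s x) \<partial>lborel)"
  proof (rule Bochner_Integration.integral_cong)
    fix x
    have "\<omega> * normal_density \<mu> \<sigma> x * indicator {0..} x * cdf (distr M borel R) (t - x) =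
        \<omega> * (indicator {0..t} x * normal_density \<mu> \<sigma> x) -
        \<omega> * (indicator {0..t} x * (exp (- (t - x)\<^sup>2 / \<beta>) * normal_density \<mu> \<sigma> x))"
      by (auto simp: R indicator_def algebra_simps)
    then show "\<omega> * normal_density \<mu> \<sigma> x * indicator {0..} x * cdf (distr M borel R) (t - x) =
      \<omega> * (indicator {0..t} x * normal_density \<mu> \<sigma> x) -
      \<omega> * ?K * (indicator {0..t} x * normal_density ?c ?s x)"
      unfolding rayleigh_tail_mult_normal_density[OF pos(1,2) a] by simp
  qed simp
  also have "\<dots> = \<omega> * (LBINT x:{0..t}. normal_density \<mu> \<sigma> x) - \<omega> * ?K * (LBINT x:{0..t}. normal_density ?c ?s x)"
    using set_integrable_normal_density[of \<sigma> "{0..t}" \<mu>] set_integrable_normal_density[of ?s "{0..t}" ?c] pos \<open>0 < a\<close>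
    by (simp add: set_integrable_def set_lebesgue_integral_def)
  also have "(LBINT x:{0..t}. normal_density \<mu> \<sigma> x) = gaussian_Q (- \<mu> / \<sigma>) - gaussian_Q ((t - \<mu>) / \<sigma>)"
    using pos by (subst normal_integral_atLeastAtMost) auto
  also have "(LBINT x:{0..t}. normal_density ?c ?s x) =
      1 - gaussian_Q (sqrt (2 / a) * (t / \<beta> + \<mu> / (2 * \<sigma>\<^sup>2))) - gaussian_Q (sqrt (2 / a) * ((t - \<mu>) / (2 * \<sigma>\<^sup>2)))"
  proof -
    \<comment> \<open>Dividing by the standard deviation multiplies by sqrt (2 a), and the centre
      carries 1 / a; together they give the factor sqrt (2 / a).\<close>
    have s: "sqrt (2 / a) = sqrt (2 * a) / a"
      using \<open>0 < a\<close> by (simp add: real_sqrt_mult real_sqrt_divide field_simps)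
    \<comment> \<open>The lower endpoint enters Q with a minus sign; reflection turns this value
      into 1 - Q, the source of the 1 in the bracket.\<close>
    have "(0 - ?c) / ?s = - (sqrt (2 / a) * (t / \<beta> + \<mu> / (2 * \<sigma>\<^sup>2)))"
      by (simp add: s)
    moreover have "(t - ?c) / ?s = sqrt (2 / a) * ((t - \<mu>) / (2 * \<sigma>\<^sup>2))"
    proof -
      have "t - ?c = (t * a - (t / \<beta> + \<mu> / (2 * \<sigma>\<^sup>2))) / a"
        using \<open>0 < a\<close> by (simp add: diff_divide_distrib)
      \<comment> \<open>The summand t / \<beta> of \<open>t * a\<close> cancels by the definition of
        \<open>a\<close>.\<close>
      also have "t * a - (t / \<beta> + \<mu> / (2 * \<sigma>\<^sup>2)) = (t - \<mu>) / (2 * \<sigma>\<^sup>2)"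
        by (simp add: a distrib_left diff_divide_distrib)
      finally have "t - ?c = ((t - \<mu>) / (2 * \<sigma>\<^sup>2)) / a" .
      then show ?thesis by (simp only: s) (simp add: mult_ac)
    qed
    moreover have "(LBINT x:{0..t}. normal_density ?c ?s x) = gaussian_Q ((0 - ?c) / ?s) - gaussian_Q ((t - ?c) / ?s)"
      using pos \<open>0 < a\<close> by (intro normal_integral_atLeastAtMost) auto
    ultimately show ?thesis
      by (simp only: gaussian_Q_uminus)
  qed
  finally show ?thesis by (simp add: mult.assoc)
qed

section \<open>The outage probability\<close>

theorem mainTheorem1:
  fixes P :: "'a measure"
    and h\<^sub>s\<^sub>d :: "'a \<Rightarrow> complex" and h\<^sub>b\<^sub>d :: "nat \<Rightarrow> 'a \<Rightarrow> complex"
    and R X \<gamma>\<^sub>s\<^sub>r\<^sub>d \<gamma>\<^sub>v \<Gamma>\<^sub>d :: "'a \<Rightarrow> real"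
    and N M :: nat
    and \<beta>\<^sub>s\<^sub>r \<beta>\<^sub>r\<^sub>d \<beta>\<^sub>s\<^sub>d \<beta>\<^sub>b\<^sub>d g\<^sub>s g\<^sub>b \<alpha> \<alpha>\<^sub>b\<^sub>d \<mu> \<sigma> \<omega> \<gamma>\<^sub>t\<^sub>h a\<^sub>t p_out \<A> \<B> :: real
    and f\<^sub>v :: "real \<Rightarrow> real"
  assumes "prob_space P"
    and "N \<ge> 1" and "M \<ge> 1"
    and "\<beta>\<^sub>s\<^sub>r > 0" and "\<beta>\<^sub>r\<^sub>d > 0" and "\<beta>\<^sub>s\<^sub>d > 0" and "\<beta>\<^sub>b\<^sub>d > 0" and "g\<^sub>s > 0" and "g\<^sub>b > 0"
    and "0 < \<alpha>" and "\<alpha> \<le> 1"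
    and "\<mu> = real N * \<alpha> * pi / 4 * sqrt (\<beta>\<^sub>s\<^sub>r * \<beta>\<^sub>r\<^sub>d)"
    and "\<sigma> > 0" and "\<sigma>\<^sup>2 = real N * \<alpha>\<^sup>2 * \<beta>\<^sub>s\<^sub>r * \<beta>\<^sub>r\<^sub>d * (1 - pi\<^sup>2 / 16)"
    and "\<omega> = 1 / gaussian_Q (- \<mu> / \<sigma>)"
    \<comment> \<open>the random variables\<close>
    and "complex_normal P h\<^sub>s\<^sub>d 0 \<beta>\<^sub>s\<^sub>d" and "R = (\<lambda>w. cmod (h\<^sub>s\<^sub>d w))"
    and "X \<in> borel_measurable P" and "AE w in P. X w \<ge> 0"
    and "\<And>x. cdf (distr P borel X) x = (if x \<ge> 0 then 1 - \<omega> * gaussian_Q ((x - \<mu>) / \<sigma>) else 0)"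
    and "\<And>m. m \<in> {1..M} \<Longrightarrow> complex_normal P (h\<^sub>b\<^sub>d m) 0 \<beta>\<^sub>b\<^sub>d"
    and "prob_space.indep_vars P (\<lambda>_. borel) (channel_var R X h\<^sub>b\<^sub>d)
           ({Direct, Reflected} \<union> Backscatter ` {1..M})"
    \<comment> \<open>signal-to-noise ratios, and the density of \<open>\<gamma>\<^sub>v\<close>\<close>
    and "\<gamma>\<^sub>s\<^sub>r\<^sub>d = (\<lambda>w. g\<^sub>s * (R w + X w)\<^sup>2)"
    and "\<gamma>\<^sub>v = (\<lambda>w. 1 + g\<^sub>b * (MAX m\<in>{1..M}. (cmod (h\<^sub>b\<^sub>d m w))\<^sup>2))"
    and "\<Gamma>\<^sub>d = (\<lambda>w. \<gamma>\<^sub>s\<^sub>r\<^sub>d w / \<gamma>\<^sub>v w)"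
    and "\<alpha>\<^sub>b\<^sub>d = g\<^sub>b * \<beta>\<^sub>b\<^sub>d"
    and "f\<^sub>v = (\<lambda>x. if x \<ge> 1
           then \<Sum>m=1..M. (-1) ^ (m + 1) * real (M choose m) * (real m / \<alpha>\<^sub>b\<^sub>d) * exp (- real m * (x - 1) / \<alpha>\<^sub>b\<^sub>d)
           else 0)"
    \<comment> \<open>outage probability\<close>
    and "\<gamma>\<^sub>t\<^sub>h > 0"
    and "p_out = measure P {w \<in> space P. \<Gamma>\<^sub>d w \<le> \<gamma>\<^sub>t\<^sub>h}"
    and "a\<^sub>t = 1 / \<beta>\<^sub>s\<^sub>d + 1 / (2 * \<sigma>\<^sup>2)"
    and "\<A> = 1 - \<omega> * (LBINT x:{0..}.
           gaussian_Q ((sqrt (\<gamma>\<^sub>t\<^sub>h * x) - \<mu> * sqrt g\<^sub>s) / (\<sigma> * sqrt g\<^sub>s)) * f\<^sub>v x)"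
    and "\<B> = (LBINT x:{0..}.
           exp (- ((sqrt (\<gamma>\<^sub>t\<^sub>h * x) - \<mu> * sqrt g\<^sub>s)\<^sup>2 / (2 * \<beta>\<^sub>s\<^sub>d * a\<^sub>t * g\<^sub>s * \<sigma>\<^sup>2)))
           * (1 - gaussian_Q (sqrt (2 / (a\<^sub>t * g\<^sub>s)) * (sqrt (\<gamma>\<^sub>t\<^sub>h * x) / \<beta>\<^sub>s\<^sub>d + \<mu> * sqrt g\<^sub>s / (2 * \<sigma>\<^sup>2)))
                - gaussian_Q (sqrt (2 / (a\<^sub>t * g\<^sub>s)) * ((sqrt (\<gamma>\<^sub>t\<^sub>h * x) - \<mu> * sqrt g\<^sub>s) / (2 * \<sigma>\<^sup>2))))
           * f\<^sub>v x)"
  shows "p_out = \<A> - \<omega> * sqrt \<beta>\<^sub>s\<^sub>d / sqrt (\<beta>\<^sub>s\<^sub>d + 2 * \<sigma>\<^sup>2) * \<B>"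
proof -
  note M = assms(3) and pos = assms(6,7,8,9) and \<sigma> = assms(13) and \<omega> = assms(15)
    and hsd = assms(16) and R = assms(17) and X_meas [measurable] = assms(18) and X_nonneg = assms(19)
    and X_cdf = assms(20) and hbd = assms(21) and ind = assms(22) and \<gamma>srd = assms(23) and \<gamma>v = assms(24)
    and \<Gamma>d = assms(25) and \<alpha>bd = assms(26) and fv = assms(27) and \<gamma>th = assms(28) and p_out = assms(29)
    and a = assms(30) and \<A> = assms(31) and \<B> = assms(32)
  interpret prob_space P by fact
  have \<mu>: "0 \<le> \<mu>"
    unfolding assms(12) using assms(4,5,10)
    by (intro mult_nonneg_nonneg divide_nonneg_pos real_sqrt_ge_zero) auto
  have Q0: "0 < gaussian_Q (- \<mu> / \<sigma>)"
    using \<mu> \<sigma> by (intro gaussian_Q_pos_of_nonpos) simp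
  have \<omega>0: "0 \<le> \<omega>" and \<omega>Q: "\<omega> * gaussian_Q (- \<mu> / \<sigma>) = 1"
    using Q0 by (simp_all add: \<omega>)
  have \<alpha>0: "0 < \<alpha>\<^sub>b\<^sub>d" using pos by (simp add: \<alpha>bd)
  have a0: "0 < a\<^sub>t" using pos \<sigma> by (auto simp: a intro!: add_pos_pos)
  have R_cdf: "cdf (distr P borel R) r = (if 0 \<le> r then 1 - exp (- r\<^sup>2 / \<beta>\<^sub>s\<^sub>d) else 0)" for r
    unfolding R by (rule cdf_cmod_complex_normal[OF hsd pos(1)])
  have X_distr: "distr P borel X = density lborel (\<lambda>x. ennreal (\<omega> * normal_density \<mu> \<sigma> x * indicator {0..} x))"
    by (rule distr_eq_truncated_normal_density[OF _ \<sigma> \<mu> \<omega> X_cdf]) simp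
  have hsd_meas [measurable]: "h\<^sub>s\<^sub>d \<in> borel_measurable P"
    using hsd by (auto simp: complex_normal_def dest: distributed_measurable)
  have [measurable]: "R \<in> borel_measurable P" by (simp add: R)

  let ?I = "Backscatter ` {1..M}"
  let ?Z = "channel_var R X h\<^sub>b\<^sub>d"
  \<comment> \<open>The maximum is re-indexed by channels to match the independent family.\<close>
  have \<gamma>v_Z: "\<gamma>\<^sub>v = (\<lambda>w. 1 + g\<^sub>b * (MAX i\<in>?I. (cmod (?Z i w))\<^sup>2))"
    by (simp add: \<gamma>v image_image)
  have indep_R_X: "indep_var borel R borel X"
    by (rule indep_direct_reflected[OF ind])
  have indep_U_\<gamma>v: "indep_var borel (\<lambda>w. R w + X w) borel \<gamma>\<^sub>v"
    unfolding \<gamma>v_Z by (rule indep_sum_Max_backscatter[OF ind])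
  have [measurable]: "\<gamma>\<^sub>v \<in> borel_measurable P"
    using indep_var_rv2[OF indep_U_\<gamma>v] by simp
  \<comment> \<open>This holds pointwise, not just almost surely; it permits clearing the
    denominator of \<open>\<Gamma>\<^sub>d\<close> and using formulas valid only from 1 on.\<close>
  have \<gamma>v_ge: "1 \<le> \<gamma>\<^sub>v w" for w
  proof -
    have "(cmod (h\<^sub>b\<^sub>d 1 w))\<^sup>2 \<le> (MAX m\<in>{1..M}. (cmod (h\<^sub>b\<^sub>d m w))\<^sup>2)"
      using M by (intro Max_ge) auto
    then have "0 \<le> (MAX m\<in>{1..M}. (cmod (h\<^sub>b\<^sub>d m w))\<^sup>2)"
      using zero_le_power2 order_trans by blast
    then show ?thesis using pos by (simp add: \<gamma>v)
  qed

  \<comment> \<open>The product form shows the nonnegativity hidden in the alternating sum and has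
    an evident primitive.\<close>
  have fv_eq: "f\<^sub>v x = real M / \<alpha>\<^sub>b\<^sub>d * exp (- (x - 1) / \<alpha>\<^sub>b\<^sub>d) * (1 - exp (- (x - 1) / \<alpha>\<^sub>b\<^sub>d)) ^ (M - 1)"
    if "1 \<le> x" for x
  proof -
    let ?q = "exp (- (x - 1) / \<alpha>\<^sub>b\<^sub>d)"
    have "exp (- real m * (x - 1) / \<alpha>\<^sub>b\<^sub>d) = ?q ^ m" for m
      unfolding exp_of_nat_mult[symmetric] by (simp add: algebra_simps)
    then have "f\<^sub>v x = (\<Sum>m=1..M. (- 1) ^ (m + 1) * real (M choose m) * real m * ?q ^ m) / \<alpha>\<^sub>b\<^sub>d"
      using that by (simp add: fv sum_divide_distrib)
    then show ?thesis
      by (simp only: sum_choose_weighted[OF M]) simp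
  qed
  have fv_0: "f\<^sub>v x = 0" if "x < 1" for x
    using that by (simp add: fv)
  have fv_nonneg: "0 \<le> f\<^sub>v x" for x
  proof (cases "1 \<le> x")
    case True
    then show ?thesis
      using \<alpha>0 by (auto simp: fv_eq divide_nonpos_pos intro!: divide_nonneg_pos mult_nonneg_nonneg)
  qed (simp add: fv_0)
  have fv_meas [measurable]: "f\<^sub>v \<in> borel_measurable borel"
    unfolding fv by measurable
  have \<gamma>v_distr: "distr P borel \<gamma>\<^sub>v = density lborel f\<^sub>v"
  proof (rule real_distribution_eq_densityI)
    fix x
    have "indep_vars (\<lambda>_. borel) ?Z ?I"
      using ind by (rule indep_vars_subset) auto
    then have "cdf (distr P borel \<gamma>\<^sub>v) x =
        (if 1 \<le> x then (1 - exp (- (x - 1) / (g\<^sub>b * \<beta>\<^sub>b\<^sub>d))) ^ card ?I else 0)"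
      unfolding \<gamma>v_Z using M hbd pos by (intro cdf_affine_Max_complex_normal) auto
    moreover have "card ?I = M"
      by (subst card_image) (auto simp: inj_on_def)
    ultimately show "emeasure (density lborel f\<^sub>v) {..x} = ennreal (cdf (distr P borel \<gamma>\<^sub>v) x)"
      using emeasure_density_exponential_max[OF \<alpha>0 M fv_eq fv_0 fv_meas] by (simp add: \<alpha>bd)
  qed simp

  let ?t = "\<lambda>x. sqrt (\<gamma>\<^sub>t\<^sub>h * x / g\<^sub>s)"
  define q where "q x = gaussian_Q ((sqrt (\<gamma>\<^sub>t\<^sub>h * x) - \<mu> * sqrt g\<^sub>s) / (\<sigma> * sqrt g\<^sub>s))" for x
  define b where "b x = exp (- ((sqrt (\<gamma>\<^sub>t\<^sub>h * x) - \<mu> * sqrt g\<^sub>s)\<^sup>2 / (2 * \<beta>\<^sub>s\<^sub>d * a\<^sub>t * g\<^sub>s * \<sigma>\<^sup>2)))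
           * (1 - gaussian_Q (sqrt (2 / (a\<^sub>t * g\<^sub>s)) * (sqrt (\<gamma>\<^sub>t\<^sub>h * x) / \<beta>\<^sub>s\<^sub>d + \<mu> * sqrt g\<^sub>s / (2 * \<sigma>\<^sup>2)))
                - gaussian_Q (sqrt (2 / (a\<^sub>t * g\<^sub>s)) * ((sqrt (\<gamma>\<^sub>t\<^sub>h * x) - \<mu> * sqrt g\<^sub>s) / (2 * \<sigma>\<^sup>2))))" for x
  let ?k = "\<omega> * sqrt \<beta>\<^sub>s\<^sub>d / sqrt (\<beta>\<^sub>s\<^sub>d + 2 * \<sigma>\<^sup>2)"
  have [measurable]: "q \<in> borel_measurable borel" "b \<in> borel_measurable borel"
    unfolding q_def[abs_def] b_def[abs_def] by measurable
  \<comment> \<open>\<open>q\<close> and \<open>b\<close> are the integrands of \<open>\<A>\<close>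
    and \<open>\<B>\<close> without the density; the bounds make them integrable under the law of
    \<open>\<gamma>\<^sub>v\<close>.\<close>
  have q_bound: "\<bar>q x\<bar> \<le> 1" for x
    using gaussian_Q_nonneg gaussian_Q_le_1 by (simp add: q_def)
  have b_bound: "\<bar>b x\<bar> \<le> 1" for x
  proof -
    have "\<bar>1 - gaussian_Q y - gaussian_Q z\<bar> \<le> 1" for y z
      using gaussian_Q_nonneg[of y] gaussian_Q_nonneg[of z] gaussian_Q_le_1[of y] gaussian_Q_le_1[of z] by linarith
    then show ?thesis
      unfolding b_def abs_mult using pos a0 by (intro mult_le_one) auto
  qed
  \<comment> \<open>Since sqrt (\<open>\<gamma>\<^sub>t\<^sub>h\<close> x) is the threshold
    \<open>?t x\<close> times the root of \<open>g\<^sub>s\<close>, that root cancels throughout,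
    leaving the cdf of R + X; its constant term is 1 by the choice of \<omega>.\<close>
  have U_cdf: "cdf (distr P borel (\<lambda>w. R w + X w)) (?t x) = 1 - \<omega> * q x - ?k * b x" if "1 \<le> x" for x
  proof -
    have t: "sqrt (\<gamma>\<^sub>t\<^sub>h * x) = ?t x * sqrt g\<^sub>s"
      using pos by (simp add: real_sqrt_divide)
    have t0: "0 \<le> ?t x" using pos \<gamma>th that by simp
    have d: "?t x * sqrt g\<^sub>s - \<mu> * sqrt g\<^sub>s = (?t x - \<mu>) * sqrt g\<^sub>s"
      by (simp add: algebra_simps)
    have s: "sqrt (2 / (a\<^sub>t * g\<^sub>s)) = sqrt (2 / a\<^sub>t) / sqrt g\<^sub>s"
      by (simp add: real_sqrt_divide real_sqrt_mult)
    have q: "q x = gaussian_Q ((?t x - \<mu>) / \<sigma>)"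
      unfolding q_def t d using pos by simp
    have e: "(((?t x - \<mu>) * sqrt g\<^sub>s)\<^sup>2 / (2 * \<beta>\<^sub>s\<^sub>d * a\<^sub>t * g\<^sub>s * \<sigma>\<^sup>2)) = (?t x - \<mu>)\<^sup>2 / (2 * \<beta>\<^sub>s\<^sub>d * a\<^sub>t * \<sigma>\<^sup>2)"
      using pos by (simp add: power_mult_distrib)
    have l: "sqrt (2 / a\<^sub>t) / sqrt g\<^sub>s * (?t x * sqrt g\<^sub>s / \<beta>\<^sub>s\<^sub>d + \<mu> * sqrt g\<^sub>s / (2 * \<sigma>\<^sup>2)) =
        sqrt (2 / a\<^sub>t) * (?t x / \<beta>\<^sub>s\<^sub>d + \<mu> / (2 * \<sigma>\<^sup>2))"
    proof -
      have "?t x * sqrt g\<^sub>s / \<beta>\<^sub>s\<^sub>d + \<mu> * sqrt g\<^sub>s / (2 * \<sigma>\<^sup>2) = (?t x / \<beta>\<^sub>s\<^sub>d + \<mu> / (2 * \<sigma>\<^sup>2)) * sqrt g\<^sub>s"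
        by (simp add: distrib_right)
      then show ?thesis using pos by (simp only:) simp
    qed
    have r: "sqrt (2 / a\<^sub>t) / sqrt g\<^sub>s * ((?t x - \<mu>) * sqrt g\<^sub>s / (2 * \<sigma>\<^sup>2)) = sqrt (2 / a\<^sub>t) * ((?t x - \<mu>) / (2 * \<sigma>\<^sup>2))"
      using pos by simp
    have b: "b x = exp (- ((?t x - \<mu>)\<^sup>2 / (2 * \<beta>\<^sub>s\<^sub>d * a\<^sub>t * \<sigma>\<^sup>2))) *
       (1 - gaussian_Q (sqrt (2 / a\<^sub>t) * (?t x / \<beta>\<^sub>s\<^sub>d + \<mu> / (2 * \<sigma>\<^sup>2))) - gaussian_Q (sqrt (2 / a\<^sub>t) * ((?t x - \<mu>) / (2 * \<sigma>\<^sup>2))))"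
      unfolding b_def t d s e l r ..
    show ?thesis
      unfolding q b cdf_add_rayleigh_truncated_normal[OF indep_R_X pos(1) \<sigma> \<omega>0 t0 R_cdf X_distr a]
      by (simp only: right_diff_distrib \<omega>Q)
  qed

  interpret V: real_distribution "distr P borel \<gamma>\<^sub>v" by simp
  interpret U: real_distribution "distr P borel (\<lambda>w. R w + X w)" by simp
  have [measurable]: "cdf (distr P borel (\<lambda>w. R w + X w)) \<in> borel_measurable borel"
    by (intro borel_measurable_mono monoI U.cdf_nondecreasing)
  have "p_out = prob {w \<in> space P. R w + X w \<le> ?t (\<gamma>\<^sub>v w)}"
    unfolding p_out
  proof (rule finite_measure_eq_AE)
    \<comment> \<open>Taking roots is an equivalence only for R + X nonnegative, which holds almost
      everywhere as \<open>X\<close> does not have to be nonnegative pointwise.\<close>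
    show "AE w in P. w \<in> {w \<in> space P. \<Gamma>\<^sub>d w \<le> \<gamma>\<^sub>t\<^sub>h} \<longleftrightarrow> w \<in> {w \<in> space P. R w + X w \<le> ?t (\<gamma>\<^sub>v w)}"
      using X_nonneg
    proof eventually_elim
      case (elim w)
      have "0 \<le> R w + X w" using elim by (simp add: R)
      moreover have "0 < \<gamma>\<^sub>v w" using \<gamma>v_ge[of w] by simp
      then have "\<Gamma>\<^sub>d w \<le> \<gamma>\<^sub>t\<^sub>h \<longleftrightarrow> (R w + X w)\<^sup>2 \<le> \<gamma>\<^sub>t\<^sub>h * \<gamma>\<^sub>v w / g\<^sub>s"
        using pos by (simp add: \<Gamma>d \<gamma>srd field_simps)
      ultimately show ?case
        using real_le_rsqrt[of "R w + X w"] sqrt_ge_absD[of "R w + X w"] by auto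
    qed
  qed (simp_all add: \<Gamma>d \<gamma>srd)
  also have "\<dots> = (\<integral>x. cdf (distr P borel (\<lambda>w. R w + X w)) (?t x) \<partial>distr P borel \<gamma>\<^sub>v)"
    by (rule prob_indep_le_function[OF indep_U_\<gamma>v]) simp
  \<comment> \<open>The formula for the cdf is available only for arguments at least 1, so the
    integral is pulled back to \<open>P\<close>, rewritten along the values of
    \<open>\<gamma>\<^sub>v\<close>, and pushed forward again.\<close>
  also have "\<dots> = (\<integral>w. cdf (distr P borel (\<lambda>w. R w + X w)) (?t (\<gamma>\<^sub>v w)) \<partial>P)"
    by (rule integral_distr) simp_all
  also have "\<dots> = (\<integral>w. 1 - \<omega> * q (\<gamma>\<^sub>v w) - ?k * b (\<gamma>\<^sub>v w) \<partial>P)"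
    by (simp only: U_cdf[OF \<gamma>v_ge])
  also have "\<dots> = (\<integral>x. 1 - \<omega> * q x - ?k * b x \<partial>distr P borel \<gamma>\<^sub>v)"
    by (rule integral_distr[symmetric]) simp_all
  also have "\<dots> = 1 - \<omega> * (\<integral>x. q x \<partial>distr P borel \<gamma>\<^sub>v) - ?k * (\<integral>x. b x \<partial>distr P borel \<gamma>\<^sub>v)"
  proof -
    have "integrable (distr P borel \<gamma>\<^sub>v) q" "integrable (distr P borel \<gamma>\<^sub>v) b"
      using q_bound b_bound by (auto intro!: V.integrable_const_bound[where B=1])
    then show ?thesis
      using V.prob_space by simp
  qed
  \<comment> \<open>Restricting to \<open>{0..}\<close> changes nothing because
    \<open>f\<^sub>v\<close> vanishes below 1; the same holds for \<open>b\<close>.\<close>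
  also have "(\<integral>x. q x \<partial>distr P borel \<gamma>\<^sub>v) = (LBINT x:{0..}. q x * f\<^sub>v x)"
    unfolding \<gamma>v_distr set_lebesgue_integral_def
    by (subst integral_real_density)
      (auto simp: fv_nonneg indicator_def fv_0 intro!: Bochner_Integration.integral_cong)
  also have "(\<integral>x. b x \<partial>distr P borel \<gamma>\<^sub>v) = (LBINT x:{0..}. b x * f\<^sub>v x)"
    unfolding \<gamma>v_distr set_lebesgue_integral_def
    by (subst integral_real_density)
      (auto simp: fv_nonneg indicator_def fv_0 intro!: Bochner_Integration.integral_cong)
  finally show ?thesis
    unfolding \<A> \<B> q_def b_def .
qed

end
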